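(* For any encoding $X$ and any equivalence of encodings $g\colon X_R\to X$, where $X_R$ is the canonical encoding of decimals, the $g$-conjugates of the operations $+_R$ and $\cdot_R$ on $X_R$ are not computable (neither of them is).
   Context: $\mathbb{N}=\{1,2,\dots\}$, $\mathbb{N}_0=\{0,1,2,\dots\}$, $D=\{0,1,\dots,9\}$. **Decimals.** A decimal is a formal infinite linear combination $d=(-)\sum_{n\le k}d_n10^n$ with an optional minus sign, $k\in\mathbb{N}_0$ (the order of $d$), $n\in\mathbb{Z}$, $d_n\in D$, such that (i) $d_k=0$ implies $k=0$; (ii) there is no $n\le k$ with $d_m=9$ for all $m\le n$; (iii) $-\sum_{n\le 0}0\cdot10^n$ is not allowed. Digits $d_n$ with $n>k$ are set to $0$. Two decimals are equal iff they have equal signs, orders and digits. $\mathbb{R}$ denotes the set of decimals. **Arithmetic of decimals.** Let $\mathbb{Q}_D\subset\mathbb{Q}$ be the subring of fractions with a finite decimal expansion. For a decimal $d=(-)\sum_{n\le k}d_n10^n\in\mathbb{R}$ of order $k$ and $m\in\mathbb{N}$ let $r(d\,|\,m)=\pm\sum_{-m\le n\le k}d_n10^n\in\mathbb{Q}_D$ (with the sign of $d$) be the value of the $m$-th truncation of $d$. A sequence $(a_n)\subset\mathbb{Q}_D$ is Cauchy if for every $k\in\mathbb{N}$ there is $n_0\in\mathbb{N}$ with $|a_m-a_n|<1/k$ for all $m,n\ge n_0$. A Cauchy sequence $(a_n)\subset\mathbb{Q}_D$ generates $d$, written $d=G(a_n)$, if for every $k\in\mathbb{N}$ there is $n_0\in\mathbb{N}$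 such that $|r(d\,|\,n)-a_n|<1/k$ for all $n\ge n_0$. Every decimal has a generating sequence and every Cauchy sequence in $\mathbb{Q}_D$ generates exactly one decimal. For $d=G(a_n)$, $e=G(b_n)$ one defines $d+_Re:=G(a_n+b_n)$ and $d\cdot_Re:=G(a_nb_n)$ (independent of the choice of generating sequences). **Encodings and operations.** For a nonempty finite alphabet $A$ let $A^{\infty}=A^{\mathbb{N}_0}$ be the set of one-way infinite words over $A$. An encoding is a nonempty subset $X\subset A^\infty$ for some nonempty finite alphabet $A$. An operation on $X$ is a map $F\colon X\times X\to X$. **Canonical encoding $X_R$.** Let $A=D\cup\{-,\xi\}$, with $\xi$ a separation symbol. A decimal $d=(-)\sum_{n\le k}d_n10^n$ of order $k$ is encoded as the word $u(d)\in A^\infty$ consisting of the minus sign if $d$ has one, then the binary digits of $k$ (least significant digit first; $0$ is written as the single digit $0$), then $\xi$, then the digits $d_k,d_{k-1},d_{k-2},\dots$ in this order. $X_R=\{u(d)\mid d\in\mathbb{R}\}$, and $+_R,\cdot_R$ are transported to $X_R$ via the bijection $d\mapsto u(d)$. **Machines and computability.** A machine $M$ (for an encoding $X\subset A^\infty$) is a Turing machine with a finite set of states containing an initial state and a terminal state, and with a finite alphabet $A'\supset A\cup\{0,1,\epsilon\}$, where $\epsilon\in A'\setminus A$ is the empty cell symbol. It operates on three bi-infinite tapes $T_1,T_2,T_3$, with cells labeled by $\mathbb{Z}$, via corresponding heads $H_1,H_2,H_3$; $H_1,H_2$ only read, $H_3$ reads and writes. An input is a triple $(x,y,m)\in X\times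 X\times\mathbb{N}_0$: the word $x=x_0x_1\dots$ is stored on $T_1$ with $x_n$ in cell $n$ and $\epsilon$ in every cell $n<0$; $y$ is stored on $T_2$ in the same way; $m$ is stored in binary on $T_3$ with the least significant digit in cell $0$ and successive digits in cells $1,2,\dots$, all other cells containing $\epsilon$. The computation starts in the initial state with every head at cell $0$. In each step, if $M$ is in the terminal state the computation terminates; otherwise, depending only on the current state and the contents of the three currently scanned cells, $M$ rewrites the scanned cell of $T_3$, moves each head by $-1$, $0$ or $+1$, and passes to a new (possibly the same) state, according to its finite instruction table. An operation $F\colon X\times X\to X$ is computed by $M$ if for every input $(x,y,m)\in X^2\times\mathbb{N}_0$ the computation of $M$ terminates with $z_m$ in cell $0$ of $T_3$ and $\epsilon$ in all other cells of $T_3$, where $F(x,y)=z_0z_1z_2\dots$. $F$ is computable if some machine computes it. **Unary machines, equivalence, conjugates.** Let $X_i\subset A_i^\infty$, $i=1,2$, be encodings. A unary machine computing a map $f\colon X_1\to X_2$ has a finite alphabet containing $\{\epsilon,0,1\}\cup A_1\cup A_2$ and works like a machine, but with only two tapes: a read-only input tape $T_1$ storing $x=x_0x_1\dots\in X_1$ (with $x_n$ in cell $n$ and $\epsilon$ in every cell $n<0$) and an input-output tape $T_2$ storing $m\in\mathbb{N}_0$ (in binary, with the least significant digit in cell $0$ and successive digits in cells $1,2,\dots$, all other cells containing $\epsilon$); for every input $(x,m)\in X_1\times\mathbb{N}_0$ it terminates with $y_m$ in cell $0$ of $T_2$ and $\epsilon$ in all other cells of $T_2$, where $f(x)=y_0y_1\dots$.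 An equivalence of $X_1$ and $X_2$ is a bijection $f\colon X_1\to X_2$ such that both $f$ and $f^{-1}$ are computed by unary machines. If $F$ is an operation on $X_1$ and $g\colon X_1\to X_2$ is a bijection, the $g$-conjugate of $F$ is the operation $F'$ on $X_2$ given by $F'(x,y):=g(F(g^{-1}(x),g^{-1}(y)))$. *)

theory Defs
  imports Complex_Main "HOL-Library.Omega_Words_Fun"
begin

section \<open>Decimals\<close>

text \<open>A decimal is given by its optional minus sign, its order and its digits at the positions
  in \<open>\<int>\<close>; equality of records is equality of signs, orders and digits.\<close>

record decimal =
  negative :: bool
  order :: nat
  digit :: "int \<Rightarrow> nat"

definition decimals :: "decimal set" where
  "decimals = {d.
     (\<forall>n. digit d n \<in> {0..9}) \<and>
     (\<forall>n > int (order d). digit d n = 0) \<and>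
     (digit d (int (order d)) = 0 \<longrightarrow> order d = 0) \<and>
     \<not> (\<exists>n \<le> int (order d). \<forall>m \<le> n. digit d m = 9) \<and>
     \<not> (negative d \<and> order d = 0 \<and> (\<forall>n \<le> 0. digit d n = 0))}"

definition finite_decimal_fractions :: "rat set" where
  "finite_decimal_fractions = {of_int a / 10 ^ n | a n. True}"

definition truncation :: "decimal \<Rightarrow> nat \<Rightarrow> rat" where
  "truncation d m =
     (if negative d then - 1 else 1) *
     (\<Sum>n = - int m .. int (order d). of_nat (digit d n) * 10 powi n)"

text \<open>Sequences are indexed by the positive integers; the value at \<open>0\<close> is irrelevant.\<close>

definition cauchy_seq :: "(nat \<Rightarrow> rat) \<Rightarrow> bool" where
  "cauchy_seq a \<longleftrightarrow>
     (\<forall>n \<ge> 1. a n \<in> finite_decimal_fractions) \<and>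
     (\<forall>k \<ge> 1. \<exists>n\<^sub>0 \<ge> 1. \<forall>m \<ge> n\<^sub>0. \<forall>n \<ge> n\<^sub>0. \<bar>a m - a n\<bar> < 1 / of_nat k)"

definition generates :: "(nat \<Rightarrow> rat) \<Rightarrow> decimal \<Rightarrow> bool" where
  "generates a d \<longleftrightarrow> cauchy_seq a \<and> d \<in> decimals \<and>
     (\<forall>k \<ge> 1. \<exists>n\<^sub>0 \<ge> 1. \<forall>n \<ge> n\<^sub>0. \<bar>truncation d n - a n\<bar> < 1 / of_nat k)"

text \<open>Every Cauchy sequence generates exactly one decimal, and the sum and the product below do
  not depend on the generating sequences, so the three descriptions are proper.\<close>

definition generated :: "(nat \<Rightarrow> rat) \<Rightarrow> decimal" where
  "generated a = (THE d. generates a d)"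

definition dec_add :: "decimal \<Rightarrow> decimal \<Rightarrow> decimal" where
  "dec_add d e =
     (THE f. \<exists>a b. generates a d \<and> generates b e \<and> f = generated (\<lambda>n. a n + b n))"

definition dec_mult :: "decimal \<Rightarrow> decimal \<Rightarrow> decimal" where
  "dec_mult d e =
     (THE f. \<exists>a b. generates a d \<and> generates b e \<and> f = generated (\<lambda>n. a n * b n))"


section \<open>Encodings and conjugate operations\<close>

text \<open>The type parameter supplies arbitrary further symbols, so that an encoding may use any
  finite alphabet whatsoever, sharing symbols with the alphabet of the canonical encoding or not.
  Only the constructors \<open>Digit 0\<close> to \<open>Digit 9\<close> are decimal digits; the others ensure that machines
  never run out of auxiliary symbols, even if the type parameter is finite.\<close>

datatype 'a symbol = Digit nat | Minus | Sep | Other 'a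

definition encoding :: "'a symbol set \<Rightarrow> 'a symbol word set \<Rightarrow> bool" where
  "encoding A X \<longleftrightarrow> finite A \<and> A \<noteq> {} \<and> X \<noteq> {} \<and> (\<forall>x \<in> X. range x \<subseteq> A)"

definition conjugate :: "'x set \<Rightarrow> ('x \<Rightarrow> 'y) \<Rightarrow> ('x \<Rightarrow> 'x \<Rightarrow> 'x) \<Rightarrow> 'y \<Rightarrow> 'y \<Rightarrow> 'y" where
  "conjugate X g F = (\<lambda>x y. g (F (inv_into X g x) (inv_into X g y)))"


section \<open>The canonical encoding of decimals\<close>

text \<open>Binary digits, least significant first; \<open>0\<close> is written as the single digit \<open>0\<close>.\<close>

fun binary :: "nat \<Rightarrow> nat list" where
  "binary n = (if n < 2 then [n] else (n mod 2) # binary (n div 2))"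

declare binary.simps [simp del]

definition canonical_alphabet :: "'a symbol set" where
  "canonical_alphabet = Digit ` {0..9} \<union> {Minus, Sep}"

definition encode :: "decimal \<Rightarrow> 'a symbol word" where
  "encode d =
     ((if negative d then [Minus] else []) @ map Digit (binary (order d)) @ [Sep])
     \<frown> (\<lambda>i. Digit (digit d (int (order d) - int i)))"

definition X_R :: "'a symbol word set" where
  "X_R = encode ` decimals"

definition plus_R :: "'a symbol word \<Rightarrow> 'a symbol word \<Rightarrow> 'a symbol word" where
  "plus_R = conjugate decimals encode dec_add"

definition times_R :: "'a symbol word \<Rightarrow> 'a symbol word \<Rightarrow> 'a symbol word" where
  "times_R = conjugate decimals encode dec_mult"


section \<open>Machines\<close>

text \<open>The content \<open>None\<close> of a cell is the empty cell symbol, which thus lies outside every alphabet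
  of an encoding.\<close>

type_synonym 'a cell = "'a symbol option"

type_synonym 'a tape = "int \<Rightarrow> 'a cell"

text \<open>The instruction table maps a state, the scanned cells of the read-only tapes and the
  scanned cell of the working tape to the new state, the moves of the heads on the read-only
  tapes, the symbol written on the working tape and the move of its head.\<close>

record 'a machine =
  states :: "nat set"
  initial :: nat
  terminal :: nat
  alphabet :: "'a cell set"
  table :: "nat \<Rightarrow> 'a cell list \<Rightarrow> 'a cell \<Rightarrow> nat \<times> int list \<times> 'a cell \<times> int"

text \<open>\<open>machine k A M\<close>: \<open>M\<close> is a machine for the alphabet \<open>A\<close> with \<open>k\<close> read-only tapes and a
  working tape. Operations are computed with \<open>k = 2\<close>, unary maps with \<open>k = 1\<close>.\<close>

definition machine :: "nat \<Rightarrow> 'a symbol set \<Rightarrow> 'a machine \<Rightarrow> bool" where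
  "machine k A M \<longleftrightarrow>
     finite (states M) \<and> initial M \<in> states M \<and> terminal M \<in> states M \<and>
     finite (alphabet M) \<and> Some ` (A \<union> {Digit 0, Digit 1}) \<union> {None} \<subseteq> alphabet M \<and>
     (\<forall>q \<in> states M - {terminal M}. \<forall>cs c.
        length cs = k \<and> set cs \<subseteq> alphabet M \<and> c \<in> alphabet M \<longrightarrow>
        (case table M q cs c of (q', vs, c', v) \<Rightarrow>
           q' \<in> states M \<and> length vs = k \<and> set vs \<subseteq> {-1, 0, 1} \<and>
           c' \<in> alphabet M \<and> v \<in> {-1, 0, 1}))"

record 'a config =
  state :: nat
  heads :: "int list"
  work_head :: int
  work_tape :: "'a tape"

definition step :: "'a machine \<Rightarrow> 'a tape list \<Rightarrow> 'a config \<Rightarrow> 'a config" where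
  "step M ts C =
     (if state C = terminal M then C
      else case table M (state C) (map2 (\<lambda>t h. t h) ts (heads C)) (work_tape C (work_head C)) of
        (q, vs, c, v) \<Rightarrow>
          \<lparr>state = q, heads = map2 (+) (heads C) vs, work_head = work_head C + v,
           work_tape = (work_tape C)(work_head C := c)\<rparr>)"

definition input_tape :: "'a symbol word \<Rightarrow> 'a tape" where
  "input_tape x = (\<lambda>i. if i < 0 then None else Some (x (nat i)))"

definition number_tape :: "nat \<Rightarrow> 'a tape" where
  "number_tape m =
     (\<lambda>i. if 0 \<le> i \<and> i < int (length (binary m)) then Some (Digit (binary m ! nat i)) else None)"

definition output_tape :: "'a symbol \<Rightarrow> 'a tape" where
  "output_tape z = (\<lambda>_. None)(0 := Some z)"

definition start :: "'a machine \<Rightarrow> 'a tape list \<Rightarrow> nat \<Rightarrow> 'a config" where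
  "start M ts m =
     \<lparr>state = initial M, heads = map (\<lambda>_. 0) ts, work_head = 0, work_tape = number_tape m\<rparr>"

definition outputs :: "'a machine \<Rightarrow> 'a symbol word list \<Rightarrow> nat \<Rightarrow> 'a symbol \<Rightarrow> bool" where
  "outputs M xs m z \<longleftrightarrow>
     (let ts = map input_tape xs in
      \<exists>n. state ((step M ts ^^ n) (start M ts m)) = terminal M \<and>
          work_tape ((step M ts ^^ n) (start M ts m)) = output_tape z)"


section \<open>Computability and equivalence of encodings\<close>

definition computable ::
  "'a symbol set \<Rightarrow> 'a symbol word set \<Rightarrow> ('a symbol word \<Rightarrow> 'a symbol word \<Rightarrow> 'a symbol word) \<Rightarrow> bool"
where
  "computable A X F \<longleftrightarrow>
     (\<exists>M. machine 2 A M \<and> (\<forall>x \<in> X. \<forall>y \<in> X. \<forall>m. outputs M [x, y] m (F x y m)))"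

definition unary_computable ::
  "'a symbol set \<Rightarrow> 'a symbol word set \<Rightarrow> 'a symbol set \<Rightarrow> ('a symbol word \<Rightarrow> 'a symbol word) \<Rightarrow> bool"
where
  "unary_computable A\<^sub>1 X\<^sub>1 A\<^sub>2 f \<longleftrightarrow>
     (\<exists>M. machine 1 (A\<^sub>1 \<union> A\<^sub>2) M \<and> (\<forall>x \<in> X\<^sub>1. \<forall>m. outputs M [x] m (f x m)))"

definition equivalence ::
  "'a symbol set \<Rightarrow> 'a symbol word set \<Rightarrow> 'a symbol set \<Rightarrow> 'a symbol word set
    \<Rightarrow> ('a symbol word \<Rightarrow> 'a symbol word) \<Rightarrow> bool"
where
  "equivalence A\<^sub>1 X\<^sub>1 A\<^sub>2 X\<^sub>2 g \<longleftrightarrow>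
     bij_betw g X\<^sub>1 X\<^sub>2 \<and> unary_computable A\<^sub>1 X\<^sub>1 A\<^sub>2 g \<and>
     unary_computable A\<^sub>2 X\<^sub>2 A\<^sub>1 (inv_into X\<^sub>1 g)"

end

theory Submission
  imports Defs
begin

text \<open>
  The obstruction is topological. A terminating computation moves its heads only finitely often, so
  each output symbol depends on finite prefixes of the inputs, and computable maps are continuous
  for the topology of symbolwise convergence (\<open>machine_continuous\<close>). If a conjugate of an operation
  \<open>F\<close> under an equivalence \<open>g\<close> were computable, then \<open>F\<close>, being that conjugate with \<open>g\<close> applied to
  the arguments and the inverse of \<open>g\<close> to the result, would be a composition of continuous maps
  (\<open>computable_conjugate_continuous\<close>).

  But addition and multiplication of decimals are discontinuous where the result is a finite
  decimal that can be approached from below in absolute value, because words beginning \<open>0.999\<close> are close to the number one but not to its word. For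
  addition, \<open>10\<^sup>-\<^sup>n\<close> converges symbolwise to \<open>0\<close>, while \<open>- 1 + 10\<^sup>-\<^sup>n = - 0.9\<dots>9\<close> does not converge
  symbolwise to \<open>- 1\<close>. For multiplication, \<open>0.3\<dots>3\<close> converges symbolwise to \<open>1/3\<close>, while
  \<open>3 \<cdot> 0.3\<dots>3 = 0.9\<dots>9\<close> does not converge symbolwise to \<open>1\<close>.

  The arithmetic operations are defined by descriptions, so that these sums and products can be
  computed only after it is known that a decimal is determined by its real value
  (\<open>real_value_inject\<close>). This is uniqueness of decimal expansions without a tail of nines. It turns
  every equation between decimals into an equation between reals (\<open>dec_add_eq\<close>, \<open>dec_mult_eq\<close>).
\<close>

section \<open>Computable maps are continuous\<close>

text \<open>Convergence in the product of discrete topologies. Sequences suffice to refute continuity, and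
  make compositions of continuous maps immediate.\<close>

definition converges :: "(nat \<Rightarrow> 'b word) \<Rightarrow> 'b word \<Rightarrow> bool" where
  "converges w x \<longleftrightarrow> (\<forall>i. \<forall>\<^sub>F n in sequentially. w n i = x i)"

lemma converges_const: "converges (\<lambda>n. x) x"
  by (simp add: converges_def)

lemma step_terminal: "state C = terminal M \<Longrightarrow> (step M ts ^^ n) C = C"
  by (induction n) (simp_all add: step_def)

text \<open>A run that has reached the terminal state stays there unchanged, so two terminal
  configurations of the same run can be compared at the later of the two times.\<close>

lemma outputs_unique:
  assumes "outputs M xs m z" "outputs M xs m z'"
  shows "z = z'"
proof -
  define C where "C = (\<lambda>n. (step M (map input_tape xs) ^^ n) (start M (map input_tape xs) m))"
  have stay: "C n' = C n" if "state (C n) = terminal M" "n \<le> n'" for n n'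
  proof -
    have "C n' = (step M (map input_tape xs) ^^ (n' - n)) (C n)"
      using that(2) funpow_add[of "n' - n" n "step M (map input_tape xs)"] by (simp add: C_def)
    then show ?thesis
      using step_terminal that(1) by metis
  qed
  obtain n where n: "state (C n) = terminal M" "work_tape (C n) = output_tape z"
    using assms(1) by (auto simp: outputs_def C_def Let_def)
  obtain n' where n': "state (C n') = terminal M" "work_tape (C n') = output_tape z'"
    using assms(2) by (auto simp: outputs_def C_def Let_def)
  have "output_tape z = output_tape z'"
    using stay[OF n(1), of "max n n'"] stay[OF n'(1), of "max n n'"] n(2) n'(2) by simp
  then show ?thesis
    by (metis fun_upd_same option.inject output_tape_def)
qed

lemma step_cong:
  assumes "length ts' = length ts"
    and "\<And>j h. j < length ts \<Longrightarrow> h \<in> set (heads C) \<Longrightarrow> (ts' ! j) h = (ts ! j) h"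
  shows "step M ts' C = step M ts C"
proof -
  have "map2 (\<lambda>t h. t h) ts' (heads C) = map2 (\<lambda>t h. t h) ts (heads C)"
    by (rule nth_equalityI) (use assms in auto)
  then show ?thesis
    by (simp add: step_def)
qed

text \<open>A run of \<open>N\<close> steps reads only the cells under the heads at its first \<open>N\<close> configurations. The
  bound is taken from these positions themselves rather than from \<open>N\<close> and the speed of the heads.\<close>

lemma finite_use:
  assumes "outputs M xs m z"
  obtains B where "\<And>xs'. length xs' = length xs \<Longrightarrow>
    (\<And>j i. j < length xs \<Longrightarrow> i < B \<Longrightarrow> (xs' ! j) i = (xs ! j) i) \<Longrightarrow> outputs M xs' m z"
proof -
  define C where "C = (\<lambda>n. (step M (map input_tape xs) ^^ n) (start M (map input_tape xs) m))"
  obtain N where N: "state (C N) = terminal M" "work_tape (C N) = output_tape z"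
    using assms by (auto simp: outputs_def C_def Let_def)
  \<comment> \<open>Cells at negative positions are blank for every input, so truncating positions to naturals
    loses nothing; the inserted \<open>0\<close> makes the maximum exist if there are no heads or no steps.\<close>
  define B where "B = Suc (Max (insert 0 (nat ` (\<Union>t<N. set (heads (C t))))))"
  have B: "nat h < B" if "t < N" "h \<in> set (heads (C t))" for t h
    unfolding B_def less_Suc_eq_le by (rule Max_ge) (use that in auto)
  show thesis
  proof (rule that)
    fix xs' :: "'a symbol word list"
    assume len: "length xs' = length xs"
      and agree: "\<And>j i. j < length xs \<Longrightarrow> i < B \<Longrightarrow> (xs' ! j) i = (xs ! j) i"
    have "(step M (map input_tape xs') ^^ t) (start M (map input_tape xs') m) = C t"
      if "t \<le> N" for t
      using that
    proof (induction t)
      case 0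
      show ?case
        by (simp add: C_def start_def map_replicate_const len)
    next
      case (Suc t)
      have "step M (map input_tape xs') (C t) = step M (map input_tape xs) (C t)"
        by (rule step_cong) (use len agree B Suc_le_lessD[OF Suc.prems] in \<open>auto simp: input_tape_def\<close>)
      then show ?case
        using Suc by (simp add: C_def)
    qed
    from this[OF order.refl] show "outputs M xs' m z"
      using N by (auto simp: outputs_def Let_def intro!: exI[of _ N])
  qed
qed

lemma machine_continuous:
  assumes compute: "\<And>n. outputs M (xs n) m (F n)" "outputs M x m z"
    and length: "\<And>n. length (xs n) = length x"
    and converge: "\<And>j. j < length x \<Longrightarrow> converges (\<lambda>n. xs n ! j) (x ! j)"
  shows "\<forall>\<^sub>F n in sequentially. F n = z"
proof -
  obtain B where B: "\<And>xs'. length xs' = length x \<Longrightarrow>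
    (\<And>j i. j < length x \<Longrightarrow> i < B \<Longrightarrow> (xs' ! j) i = (x ! j) i) \<Longrightarrow> outputs M xs' m z"
    using finite_use[OF compute(2)] by blast
  have "\<forall>\<^sub>F n in sequentially. \<forall>j\<in>{..<length x}. \<forall>i\<in>{..<B}. (xs n ! j) i = (x ! j) i"
    using converge by (intro eventually_ball_finite ballI) (auto simp: converges_def)
  then show ?thesis
    by eventually_elim (use B length compute(1) outputs_unique in \<open>metis lessThan_iff\<close>)
qed

lemma unary_computable_continuous:
  assumes "unary_computable A X A' f" "\<And>n. w n \<in> X" "x \<in> X" "converges w x"
  shows "converges (\<lambda>n. f (w n)) (f x)"
proof -
  obtain M where "\<And>x m. x \<in> X \<Longrightarrow> outputs M [x] m (f x m)"
    using assms(1) by (auto simp: unary_computable_def)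
  then show ?thesis
    unfolding converges_def[of _ "f x"] using assms(2-4)
    by (auto intro!: machine_continuous[where M = M and xs = "\<lambda>n. [w n]" and x = "[x]"])
qed

lemma computable_continuous:
  assumes "computable A X F" "\<And>n. v n \<in> X" "x \<in> X" "converges v x"
    and "\<And>n. w n \<in> X" "y \<in> X" "converges w y"
  shows "converges (\<lambda>n. F (v n) (w n)) (F x y)"
proof -
  obtain M where "\<And>x y m. x \<in> X \<Longrightarrow> y \<in> X \<Longrightarrow> outputs M [x, y] m (F x y m)"
    using assms(1) by (auto simp: computable_def)
  then show ?thesis
    unfolding converges_def[of _ "F x y"] using assms(2-)
    by (auto intro!: machine_continuous[where M = M and xs = "\<lambda>n. [v n, w n]" and x = "[x, y]"]
        simp: less_Suc_eq)
qed

text \<open>Sequential continuity passes from the conjugate back to the operation: map the arguments by \<open>g\<close>,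
  apply the conjugate, and map the result back by the inverse of \<open>g\<close>, all three being
  continuous.\<close>

lemma computable_conjugate_continuous:
  assumes "equivalence A X A' X' g" "computable A' X' (conjugate X g F)"
    and v: "\<And>n. v n \<in> X" "x \<in> X" "converges v x"
    and w: "\<And>n. w n \<in> X" "y \<in> X" "converges w y"
    and F: "\<And>n. F (v n) (w n) \<in> X" "F x y \<in> X"
  shows "converges (\<lambda>n. F (v n) (w n)) (F x y)"
proof -
  have bij: "bij_betw g X X'"
    and g: "unary_computable A X A' g" and g': "unary_computable A' X' A (inv_into X g)"
    using assms(1) by (auto simp: equivalence_def)
  have inv: "inv_into X g (g u) = u" if "u \<in> X" for u
    using bij that by (simp add: bij_betw_inv_into_left)
  have mem: "g u \<in> X'" if "u \<in> X" for u
    using bij that by (auto simp: bij_betw_def)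
  have conj: "conjugate X g F (g u) (g u') = g (F u u')" if "u \<in> X" "u' \<in> X" for u u'
    using that by (simp add: conjugate_def inv)
  have "converges (\<lambda>n. conjugate X g F (g (v n)) (g (w n))) (conjugate X g F (g x) (g y))"
    by (rule computable_continuous[OF assms(2)]; intro unary_computable_continuous[OF g] mem v w)
  then have "converges (\<lambda>n. g (F (v n) (w n))) (g (F x y))"
    using v w by (simp add: conj)
  then have "converges (\<lambda>n. inv_into X g (g (F (v n) (w n)))) (inv_into X g (g (F x y)))"
    by (rule unary_computable_continuous[OF g', rotated 2]) (intro mem F)+
  then show ?thesis
    using F by (simp add: inv)
qed


section \<open>The real value of a decimal\<close>

text \<open>The series starts at the units, so for decimal digits its value lies in
  \<open>{0..10}\<close>; the leading coefficient and the remaining ones play the parts of the integer and the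
  fractional part.\<close>

definition digit_series :: "(nat \<Rightarrow> nat) \<Rightarrow> real" where
  "digit_series c = (\<Sum>i. real (c i) * (1/10) ^ i)"

lemma digit_series_summable:
  assumes "\<And>i. c i \<le> 9"
  shows "summable (\<lambda>i. real (c i) * (1/10) ^ i)"
proof (rule summable_comparison_test')
  show "summable (\<lambda>i. 9 * (1/10::real) ^ i)"
    by (intro summable_mult summable_geometric) simp
  show "norm (real (c n) * (1/10) ^ n) \<le> 9 * (1/10) ^ n" for n
    using assms[of n] by (simp add: mult_right_mono)
qed

lemma digit_series_Suc:
  assumes "\<And>i. c i \<le> 9"
  shows "digit_series c = c 0 + digit_series (\<lambda>i. c (Suc i)) / 10"
proof -
  have "digit_series c = (\<Sum>i. real (c (Suc i)) * (1/10) ^ Suc i) + c 0"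
    unfolding digit_series_def
    using suminf_split_head[OF digit_series_summable[of c, OF assms]] by (simp del: power_Suc)
  also have "(\<Sum>i. real (c (Suc i)) * (1/10) ^ Suc i)
      = (\<Sum>i. (1/10) * (real (c (Suc i)) * (1/10) ^ i))"
    by (simp add: mult_ac)
  also have "\<dots> = (1/10) * digit_series (\<lambda>i. c (Suc i))"
    unfolding digit_series_def by (rule suminf_mult) (use assms in \<open>simp add: digit_series_summable\<close>)
  finally show ?thesis
    by simp
qed

lemma digit_series_nonneg:
  assumes "\<And>i. c i \<le> 9"
  shows "digit_series c \<ge> 0"
  unfolding digit_series_def by (rule suminf_nonneg) (use digit_series_summable[OF assms] in auto)

lemma digit_series_less_10:
  assumes "\<And>i. c i \<le> 9" "\<exists>i. c i \<noteq> 9"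
  shows "digit_series c < 10"
proof -
  obtain j where j: "c j \<noteq> 9"
    using assms(2) by blast
  have "(\<lambda>i. 9 * (1/10) ^ i) sums (9 * (1 / (1 - 1/10 :: real)))"
    by (intro sums_mult geometric_sums) simp
  then have nines: "(\<lambda>i. 9 * (1/10) ^ i) sums (10 :: real)"
    by simp
  have gap: "(\<lambda>i. 9 * (1/10) ^ i - real (c i) * (1/10) ^ i) sums (10 - digit_series c)"
    unfolding digit_series_def
    by (intro sums_diff nines summable_sums digit_series_summable assms(1))
  have "0 < (\<Sum>i. 9 * (1/10) ^ i - real (c i) * (1/10) ^ i)"
  proof (rule suminf_pos2)
    show "0 \<le> 9 * (1/10) ^ i - real (c i) * (1/10) ^ i" for i
      using assms(1)[of i] by (simp add: mult_right_mono)
    show "0 < 9 * (1/10) ^ j - real (c j) * (1/10) ^ j"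
      using assms(1)[of j] j by simp
  qed (use gap sums_summable in blast)
  then show ?thesis
    using gap by (simp add: sums_iff)
qed

text \<open>Uniqueness of decimal expansions without a tail of nines: splitting off a coefficient leaves a
  remainder in \<open>{0..<1}\<close>, so the coefficient is the integer part of the sum, and the remainders agree
  as well. Induction on the position propagates this to all coefficients.\<close>

lemma digit_series_inject:
  assumes c: "\<And>i. c i \<le> 9" "\<And>j. \<exists>i\<ge>j. c i \<noteq> 9"
    and c': "\<And>i. c' i \<le> 9" "\<And>j. \<exists>i\<ge>j. c' i \<noteq> 9"
    and eq: "digit_series c = digit_series c'"
  shows "c = c'"
proof -
  have head: "c j = c' j \<and> digit_series (\<lambda>i. c (Suc j + i)) = digit_series (\<lambda>i. c' (Suc j + i))"
    if "digit_series (\<lambda>i. c (j + i)) = digit_series (\<lambda>i. c' (j + i))" for j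
  proof -
    have bounds: "0 \<le> digit_series (\<lambda>i. b (Suc j + i)) \<and> digit_series (\<lambda>i. b (Suc j + i)) < 10
        \<and> digit_series (\<lambda>i. b (j + i)) = b j + digit_series (\<lambda>i. b (Suc j + i)) / 10"
      if b: "\<And>i. b i \<le> 9" "\<And>j. \<exists>i\<ge>j. b i \<noteq> 9" for b :: "nat \<Rightarrow> nat"
    proof -
      have "\<exists>i. b (Suc j + i) \<noteq> 9"
        using b(2)[of "Suc j"] by (metis le_iff_add)
      then show ?thesis
        using digit_series_nonneg[of "\<lambda>i. b (Suc j + i)"] digit_series_less_10[of "\<lambda>i. b (Suc j + i)"]
          digit_series_Suc[of "\<lambda>i. b (j + i)"] b(1) by simp
    qed
    have "\<bar>real (c j) - real (c' j)\<bar> < 1"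
      using bounds[OF c] bounds[OF c'] that by (simp add: abs_if; linarith)
    then have "c j = c' j"
      by linarith
    moreover have "digit_series (\<lambda>i. c (Suc j + i)) = digit_series (\<lambda>i. c' (Suc j + i))"
      using bounds[OF c] bounds[OF c'] that calculation by linarith
    ultimately show ?thesis
      by blast
  qed
  have "digit_series (\<lambda>i. c (j + i)) = digit_series (\<lambda>i. c' (j + i))" for j
  proof (induction j)
    case 0
    show ?case
      using eq by simp
  next
    case (Suc j)
    then show ?case
      using head by blast
  qed
  then have "c j = c' j" for j
    using head by blast
  then show ?thesis
    by blast
qed

definition decimal_sign :: "decimal \<Rightarrow> real" where
  "decimal_sign d = (if negative d then - 1 else 1)"

definition real_value :: "decimal \<Rightarrow> real" where
  "real_value d = decimal_sign d * 10 ^ order d * digit_series (\<lambda>i. digit d (int (order d) - int i))"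

lemma decimalsD:
  assumes "d \<in> decimals"
  shows decimal_digit_le: "digit d n \<le> 9"
    and decimal_digit_above_order: "n > int (order d) \<Longrightarrow> digit d n = 0"
    and decimal_leading_digit: "digit d (int (order d)) = 0 \<Longrightarrow> order d = 0"
    and decimal_not_all_nines: "n \<le> int (order d) \<Longrightarrow> \<exists>m\<le>n. digit d m \<noteq> 9"
    and decimal_no_negative_zero: "order d = 0 \<Longrightarrow> \<forall>n\<le>0. digit d n = 0 \<Longrightarrow> \<not> negative d"
proof -
  have *: "(\<forall>n. digit d n \<in> {0..9}) \<and>
     (\<forall>n > int (order d). digit d n = 0) \<and>
     (digit d (int (order d)) = 0 \<longrightarrow> order d = 0) \<and>
     \<not> (\<exists>n \<le> int (order d). \<forall>m \<le> n. digit d m = 9) \<and>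
     \<not> (negative d \<and> order d = 0 \<and> (\<forall>n \<le> 0. digit d n = 0))"
    using assms unfolding decimals_def by (rule CollectD)
  show "digit d n \<le> 9"
    using *[THEN conjunct1] by simp
  show "n > int (order d) \<Longrightarrow> digit d n = 0"
    using * by blast
  show "digit d (int (order d)) = 0 \<Longrightarrow> order d = 0"
    using * by blast
  show "n \<le> int (order d) \<Longrightarrow> \<exists>m\<le>n. digit d m \<noteq> 9"
    using * by blast
  show "order d = 0 \<Longrightarrow> \<forall>n\<le>0. digit d n = 0 \<Longrightarrow> \<not> negative d"
    using * by blast
qed

lemma of_rat_power_int: "of_rat (x powi n) = (of_rat x powi n :: 'a :: field_char_0)"
  by (simp add: power_int_def of_rat_power of_rat_inverse)

lemma truncation_eq:
  assumes "d \<in> decimals" "order d \<le> K"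
  shows "real_of_rat (truncation d m)
    = decimal_sign d * 10 ^ K * (\<Sum>i\<le>K + m. real (digit d (int K - int i)) * (1/10) ^ i)"
proof -
  have "(\<Sum>n = - int m .. int (order d). real (digit d n) * 10 powi n)
      = (\<Sum>n = - int m .. int K. real (digit d n) * 10 powi n)"
    by (rule sum.mono_neutral_left) (use assms decimal_digit_above_order in auto)
  also have "\<dots> = (\<Sum>i\<le>K + m. real (digit d (int K - int i)) * 10 powi (int K - int i))"
    by (rule sum.reindex_bij_witness[where i = "\<lambda>i. int K - int i" and j = "\<lambda>n. nat (int K - n)"])
      auto
  also have "\<dots> = 10 ^ K * (\<Sum>i\<le>K + m. real (digit d (int K - int i)) * (1/10) ^ i)"
    unfolding sum_distrib_left
    by (rule sum.cong) (simp_all add: power_int_diff power_one_over field_simps)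
  finally show ?thesis
    by (simp add: truncation_def decimal_sign_def of_rat_mult of_rat_sum of_rat_power_int of_rat_minus)
qed

text \<open>The reference position \<open>K\<close> may exceed the order, since the additional leading digits are zero.
  This brings two decimals of possibly different orders to a common scale.\<close>

lemma truncation_tendsto_series:
  assumes "d \<in> decimals" "order d \<le> K"
  shows "(\<lambda>m. real_of_rat (truncation d m))
    \<longlonglongrightarrow> decimal_sign d * 10 ^ K * digit_series (\<lambda>i. digit d (int K - int i))"
proof -
  have "(\<lambda>i. real (digit d (int K - int i)) * (1/10) ^ i)
      sums digit_series (\<lambda>i. digit d (int K - int i))"
    unfolding digit_series_def
    by (intro summable_sums digit_series_summable decimal_digit_le[OF assms(1)])
  then have "(\<lambda>m. \<Sum>i\<le>m + K. real (digit d (int K - int i)) * (1/10) ^ i)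
      \<longlonglongrightarrow> digit_series (\<lambda>i. digit d (int K - int i))"
    unfolding sums_def_le by (rule LIMSEQ_ignore_initial_segment)
  then show ?thesis
    unfolding truncation_eq[OF assms] by (intro tendsto_intros) (simp add: add.commute)
qed

lemma truncation_tendsto:
  assumes "d \<in> decimals"
  shows "(\<lambda>m. real_of_rat (truncation d m)) \<longlonglongrightarrow> real_value d"
  using truncation_tendsto_series[OF assms order.refl] by (simp add: real_value_def)

lemma real_value_eq:
  assumes "d \<in> decimals" "order d \<le> K"
  shows "real_value d = decimal_sign d * 10 ^ K * digit_series (\<lambda>i. digit d (int K - int i))"
  using LIMSEQ_unique[OF truncation_tendsto truncation_tendsto_series] assms by blast

text \<open>Since a leading digit \<open>0\<close> forces order \<open>0\<close>, the digits determine the order.\<close>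

lemma order_eq:
  assumes "d \<in> decimals"
  shows "order d = (LEAST k. \<forall>n>int k. digit d n = 0)"
proof (rule Least_equality[symmetric])
  show "\<forall>n>int (order d). digit d n = 0"
    using decimal_digit_above_order[OF assms] by blast
next
  fix k assume "\<forall>n>int k. digit d n = 0"
  then have "order d > k \<Longrightarrow> order d = 0"
    using decimal_leading_digit[OF assms] by simp
  then show "order d \<le> k"
    by linarith
qed

text \<open>On a common scale the absolute values agree, hence so do the digit series and the digits, and
  with them the orders. The signs agree if the value is nonzero; if it is zero, both decimals are the
  decimal \<open>0\<close>, which carries no minus sign.\<close>

lemma real_value_inject:
  assumes d: "d \<in> decimals" and e: "e \<in> decimals" and eq: "real_value d = real_value e"
  shows "d = e"
proof -
  define K where "K = max (order d) (order e)"
  define c :: "decimal \<Rightarrow> nat \<Rightarrow> nat" where "c = (\<lambda>f i. digit f (int K - int i))"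
  have c9: "c f i \<le> 9" if "f \<in> decimals" for f i
    using decimal_digit_le[OF that] by (simp add: c_def)
  have nonnine: "\<exists>i\<ge>j. c f i \<noteq> 9" if "f \<in> decimals" for f j
  proof -
    have "\<exists>m\<le>min (int (order f)) (int K - int j). digit f m \<noteq> 9"
      by (rule decimal_not_all_nines[OF that]) simp
    then obtain m where "m \<le> int K - int j" "digit f m \<noteq> 9"
      by auto
    then have "j \<le> nat (int K - m) \<and> c f (nat (int K - m)) \<noteq> 9"
      by (simp add: c_def)
    then show ?thesis
      by blast
  qed
  have val: "real_value d = decimal_sign d * 10 ^ K * digit_series (c d)"
      "real_value e = decimal_sign e * 10 ^ K * digit_series (c e)"
    unfolding c_def by (rule real_value_eq; simp add: d e K_def)+
  have pos: "digit_series (c d) \<ge> 0" "digit_series (c e) \<ge> 0"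
    using digit_series_nonneg c9 d e by blast+
  have "\<bar>real_value d\<bar> = 10 ^ K * digit_series (c d)" "\<bar>real_value e\<bar> = 10 ^ K * digit_series (c e)"
    using pos by (simp_all add: val abs_mult decimal_sign_def)
  then have series: "digit_series (c d) = digit_series (c e)"
    using eq by simp
  then have cc: "c d = c e"
    using c9 nonnine d e by (intro digit_series_inject)
  have digits: "digit d = digit e"
  proof
    fix n
    show "digit d n = digit e n"
    proof (cases "n \<le> int K")
      case True
      then show ?thesis
        using fun_cong[OF cc, of "nat (int K - n)"] by (simp add: c_def)
    next
      case False
      then show ?thesis
        using decimal_digit_above_order[OF d] decimal_digit_above_order[OF e] by (simp add: K_def)
    qed
  qed
  then have orders: "order d = order e"
    using order_eq d e by simp
  have signs: "negative d = negative e"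
  proof (cases "digit_series (c d) = 0")
    case True
    then have "c d = (\<lambda>_. 0)"
      using c9 nonnine d by (intro digit_series_inject) (auto simp: digit_series_def)
    then have "c d (nat (int K - n)) = 0" for n
      by simp
    then have zero: "digit d n = 0" if "n \<le> int K" for n
      using that unfolding c_def by (metis diff_diff_eq2 diff_ge_0_iff_ge int_nat_eq add_diff_cancel_left')
    then have "order d = 0"
      using decimal_leading_digit[OF d] by (simp add: K_def)
    moreover have "\<forall>n\<le>0. digit d n = 0"
      using zero by simp
    ultimately show ?thesis
      using decimal_no_negative_zero d e digits orders by metis
  next
    case False
    then show ?thesis
      using eq series by (auto simp: val decimal_sign_def split: if_splits)
  qed
  show ?thesis
    using digits orders signs by simp
qed


section \<open>Arithmetic of decimals\<close>

lemma rat_small_iff_tendsto: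
  fixes a b :: "nat \<Rightarrow> rat"
  shows "(\<forall>k\<ge>1. \<exists>n\<^sub>0\<ge>1. \<forall>n\<ge>n\<^sub>0. \<bar>a n - b n\<bar> < 1 / of_nat k)
    \<longleftrightarrow> (\<lambda>n. real_of_rat (a n) - real_of_rat (b n)) \<longlonglongrightarrow> 0" (is "?L \<longleftrightarrow> ?R")
proof -
  have transfer: "\<bar>a n - b n\<bar> < 1 / of_nat k
      \<longleftrightarrow> \<bar>real_of_rat (a n) - real_of_rat (b n)\<bar> < 1 / of_nat k" for n k :: nat
    unfolding of_rat_less[where 'a = real, symmetric]
    by (simp add: of_rat_divide of_rat_diff flip: abs_of_rat)
  show ?thesis
  proof
    assume L: ?L
    show ?R
    proof (rule LIMSEQ_I)
      fix r :: real assume "r > 0"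
      then obtain k where k: "inverse (real (Suc k)) < r"
        using reals_Archimedean by blast
      obtain n\<^sub>0 where "\<forall>n\<ge>n\<^sub>0. \<bar>a n - b n\<bar> < 1 / of_nat (Suc k)"
        using L by (metis One_nat_def Suc_le_mono le0)
      then show "\<exists>n\<^sub>0. \<forall>n\<ge>n\<^sub>0. norm (real_of_rat (a n) - real_of_rat (b n) - 0) < r"
        unfolding transfer using k by (fastforce simp: inverse_eq_divide)
    qed
  next
    assume R: ?R
    show ?L
    proof (intro allI impI)
      fix k :: nat assume "k \<ge> 1"
      then have "1 / real k > 0"
        by simp
      then obtain n\<^sub>0 where "\<forall>n\<ge>n\<^sub>0. norm (real_of_rat (a n) - real_of_rat (b n) - 0) < 1 / real k"
        using LIMSEQ_D[OF R] by blast
      then show "\<exists>n\<^sub>0\<ge>1. \<forall>n\<ge>n\<^sub>0. \<bar>a n - b n\<bar> < 1 / of_nat k"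
        unfolding transfer by (intro exI[of _ "max 1 n\<^sub>0"]) simp
    qed
  qed
qed

lemma cauchy_seq_of_tendsto:
  assumes "\<And>n. n \<ge> 1 \<Longrightarrow> a n \<in> finite_decimal_fractions"
    and "(\<lambda>n. real_of_rat (a n)) \<longlonglongrightarrow> L"
  shows "cauchy_seq a"
  unfolding cauchy_seq_def
proof (intro conjI allI impI)
  fix k :: nat assume "k \<ge> 1"
  then have "1 / real k > 0"
    by simp
  then obtain n\<^sub>0 where n\<^sub>0: "\<And>m n. m \<ge> n\<^sub>0 \<Longrightarrow> n \<ge> n\<^sub>0 \<Longrightarrow>
      norm (real_of_rat (a m) - real_of_rat (a n)) < 1 / real k"
    using CauchyD[OF LIMSEQ_imp_Cauchy[OF assms(2)]] by blast
  have "\<bar>a m - a n\<bar> < 1 / of_nat k" if "m \<ge> n\<^sub>0" "n \<ge> n\<^sub>0" for m n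
    using n\<^sub>0[OF that] unfolding of_rat_less[where 'a = real, symmetric]
    by (simp add: of_rat_divide of_rat_diff flip: abs_of_rat)
  then show "\<exists>n\<^sub>0\<ge>1. \<forall>m\<ge>n\<^sub>0. \<forall>n\<ge>n\<^sub>0. \<bar>a m - a n\<bar> < 1 / of_nat k"
    by (intro exI[of _ "max 1 n\<^sub>0"]) simp
qed (use assms(1) in simp)

text \<open>Convergence implies the Cauchy condition, so to generate a decimal is to have the real limit of
  its truncations. From here on, estimates of sequences are replaced by rules for limits.\<close>

lemma generates_iff:
  "generates a d \<longleftrightarrow> d \<in> decimals \<and> (\<forall>n\<ge>1. a n \<in> finite_decimal_fractions)
    \<and> (\<lambda>n. real_of_rat (a n)) \<longlonglongrightarrow> real_value d"
proof (cases "d \<in> decimals")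
  case True
  note trunc = truncation_tendsto[OF True]
  have "(\<lambda>n. real_of_rat (truncation d n) - real_of_rat (a n)) \<longlonglongrightarrow> 0
      \<longleftrightarrow> (\<lambda>n. real_of_rat (a n)) \<longlonglongrightarrow> real_value d"
    using tendsto_diff[OF trunc, of "\<lambda>n. real_of_rat (truncation d n) - real_of_rat (a n)" 0]
      tendsto_diff[OF trunc, of "\<lambda>n. real_of_rat (a n)" "real_value d"] by auto
  then show ?thesis
    using True cauchy_seq_of_tendsto[of a "real_value d"]
    unfolding generates_def rat_small_iff_tendsto by (auto simp: cauchy_seq_def)
qed (simp add: generates_def)

lemma generated_eq:
  assumes "generates a d"
  shows "generated a = d"
  unfolding generated_def
proof (rule the_equality)
  show "e = d" if "generates a e" for e
    using assms that LIMSEQ_unique real_value_inject by (metis generates_iff)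
qed (rule assms)

lemma finite_decimal_fractions_add:
  assumes "x \<in> finite_decimal_fractions" "y \<in> finite_decimal_fractions"
  shows "x + y \<in> finite_decimal_fractions"
proof -
  obtain a m b n where "x = of_int a / 10 ^ m" "y = of_int b / 10 ^ n"
    using assms by (auto simp: finite_decimal_fractions_def)
  then have "x + y = of_int (a * 10 ^ n + b * 10 ^ m) / 10 ^ (m + n)"
    by (simp add: add_frac_eq power_add)
  then show ?thesis
    unfolding finite_decimal_fractions_def by blast
qed

lemma finite_decimal_fractions_mult:
  assumes "x \<in> finite_decimal_fractions" "y \<in> finite_decimal_fractions"
  shows "x * y \<in> finite_decimal_fractions"
proof -
  obtain a m b n where "x = of_int a / 10 ^ m" "y = of_int b / 10 ^ n"
    using assms by (auto simp: finite_decimal_fractions_def)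
  then have "x * y = of_int (a * b) / 10 ^ (m + n)"
    by (simp add: power_add)
  then show ?thesis
    unfolding finite_decimal_fractions_def by blast
qed

lemma finite_decimal_fractions_of_int: "of_int a \<in> finite_decimal_fractions"
  unfolding finite_decimal_fractions_def by (rule CollectI, rule exI[of _ a], rule exI[of _ 0]) simp

lemma finite_decimal_fractions_powi: "10 powi n \<in> finite_decimal_fractions"
proof (cases "n \<ge> 0")
  case True
  then have "10 powi n = (of_int (10 ^ nat n) :: rat)"
    by (simp add: power_int_def)
  then show ?thesis
    using finite_decimal_fractions_of_int by metis
next
  case False
  then have "10 powi n = of_int 1 / (10 :: rat) ^ nat (- n)"
    by (simp add: power_int_def divide_simps)
  then show ?thesis
    unfolding finite_decimal_fractions_def by blast
qed

lemma truncation_finite_decimal_fraction: "truncation d m \<in> finite_decimal_fractions"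
proof -
  have "(\<Sum>n\<in>S. of_nat (digit d n) * 10 powi n) \<in> finite_decimal_fractions" if "finite S" for S
    using that
  proof induction
    case empty
    show ?case
      using finite_decimal_fractions_of_int[of 0] by simp
  next
    case (insert n S)
    then show ?case
      using finite_decimal_fractions_of_int[of "int (digit d n)"]
      by (auto intro!: finite_decimal_fractions_add finite_decimal_fractions_mult
          finite_decimal_fractions_powi)
  qed
  then show ?thesis
    unfolding truncation_def
    using finite_decimal_fractions_of_int[of 1] finite_decimal_fractions_of_int[of "- 1"]
    by (intro finite_decimal_fractions_mult) auto
qed

lemma generates_truncation:
  assumes "d \<in> decimals"
  shows "generates (truncation d) d"
  using assms by (simp add: generates_iff truncation_tendsto truncation_finite_decimal_fraction)

text \<open>The common shape of the descriptions of sum and product. The truncations show that there are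
  generating sequences at all.\<close>

lemma the_generated_eq:
  assumes "d \<in> decimals" "e \<in> decimals"
    and "\<And>a b. generates a d \<Longrightarrow> generates b e \<Longrightarrow> generates (\<lambda>n. op (a n) (b n)) f"
  shows "(THE f. \<exists>a b. generates a d \<and> generates b e \<and> f = generated (\<lambda>n. op (a n) (b n))) = f"
proof (rule the_equality)
  show "\<exists>a b. generates a d \<and> generates b e \<and> f = generated (\<lambda>n. op (a n) (b n))"
    using assms generates_truncation generated_eq by metis
qed (use assms(3) generated_eq in blast)

lemma dec_add_eq:
  assumes "d \<in> decimals" "e \<in> decimals" "f \<in> decimals"
    and "real_value f = real_value d + real_value e"
  shows "dec_add d e = f"
  unfolding dec_add_def using assms
  by (intro the_generated_eq)
    (auto simp: generates_iff of_rat_add intro: tendsto_add finite_decimal_fractions_add)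

lemma dec_mult_eq:
  assumes "d \<in> decimals" "e \<in> decimals" "f \<in> decimals"
    and "real_value f = real_value d * real_value e"
  shows "dec_mult d e = f"
  unfolding dec_mult_def using assms
  by (intro the_generated_eq)
    (auto simp: generates_iff of_rat_mult intro: tendsto_mult finite_decimal_fractions_mult)


section \<open>The canonical encoding\<close>

lemma binary_inject:
  assumes "binary m = binary n"
  shows "m = n"
proof -
  define val :: "nat list \<Rightarrow> nat" where "val = (\<lambda>xs. foldr (\<lambda>x v. x + 2 * v) xs 0)"
  have "val (binary n) = n" for n
  proof (induction n rule: less_induct)
    case (less n)
    show ?case
      using less[of "n div 2"] by (subst binary.simps) (auto simp: val_def)
  qed
  then show ?thesis
    using assms by metis
qed

lemma conc_Cons_eq_iff: "(x # xs) \<frown> v = (y # ys) \<frown> w \<longleftrightarrow> x = y \<and> xs \<frown> v = ys \<frown> w"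
proof
  assume eq: "(x # xs) \<frown> v = (y # ys) \<frown> w"
  have "(xs \<frown> v) i = (ys \<frown> w) i" for i
    using fun_cong[OF eq, of "Suc i"] by (auto simp: conc_def)
  then show "x = y \<and> xs \<frown> v = ys \<frown> w"
    using fun_cong[OF eq, of 0] by (auto simp: conc_def)
next
  assume "x = y \<and> xs \<frown> v = ys \<frown> w"
  then show "(x # xs) \<frown> v = (y # ys) \<frown> w"
    using conc_conc[of "[x]" xs v] conc_conc[of "[x]" ys w] by simp
qed

text \<open>The separation symbol is not a digit, so its first occurrence marks the end of the order.\<close>

lemma separated_inject:
  assumes "(map Digit xs @ [Sep]) \<frown> v = (map Digit ys @ [Sep]) \<frown> w"
  shows "xs = ys \<and> v = w"
  using assms
proof (induction xs arbitrary: ys)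
  case Nil
  then show ?case
    by (cases ys) (auto simp: conc_Cons_eq_iff)
next
  case (Cons x xs)
  then show ?case
    by (cases ys) (auto simp: conc_Cons_eq_iff)
qed

lemma encode_inject:
  assumes d: "d \<in> decimals" and e: "e \<in> decimals" and eq: "encode d = (encode e :: 'a symbol word)"
  shows "d = e"
proof -
  define body :: "decimal \<Rightarrow> 'a symbol word" where
    "body d = (map Digit (binary (order d)) @ [Sep]) \<frown> (\<lambda>i. Digit (digit d (int (order d) - int i)))"
    for d
  have enc: "encode d = (if negative d then [Minus] \<frown> body d else body d)" for d
    by (simp add: encode_def body_def)
  have head: "body d 0 \<noteq> Minus" for d
    by (subst body_def, subst binary.simps) (simp add: conc_def)
  have "encode d 0 = (Minus :: 'a symbol) \<longleftrightarrow> negative d" for d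
    using head[of d] by (simp add: enc conc_def)
  then have signs: "negative d = negative e"
    using eq by metis
  then have "body d = body e"
    using eq by (auto simp: enc conc_Cons_eq_iff split: if_splits)
  then have "binary (order d) = binary (order e)"
    and tail: "(\<lambda>i. Digit (digit d (int (order d) - int i)) :: 'a symbol)
      = (\<lambda>i. Digit (digit e (int (order e) - int i)))"
    unfolding body_def using separated_inject by blast+
  then have orders: "order d = order e"
    using binary_inject by blast
  have "digit d n = digit e n" for n
  proof (cases "n \<le> int (order d)")
    case True
    then show ?thesis
      using fun_cong[OF tail, of "nat (int (order d) - n)"] orders by simp
  next
    case False
    then show ?thesis
      using decimal_digit_above_order[OF d] decimal_digit_above_order[OF e] orders by simp
  qed
  then show ?thesis
    using signs orders by (simp add: fun_eq_iff)
qed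

lemma conjugate_encode:
  assumes "d \<in> decimals" "e \<in> decimals"
  shows "conjugate decimals encode F (encode d :: 'a symbol word) (encode e) = encode (F d e)"
proof -
  have "inj_on (encode :: decimal \<Rightarrow> 'a symbol word) decimals"
    using encode_inject by (auto intro: inj_onI)
  then show ?thesis
    using assms by (simp add: conjugate_def)
qed


section \<open>Discontinuity of addition and multiplication\<close>

text \<open>All decimals of the counterexamples have order \<open>0\<close> and use at most one nonzero digit. The index set
  counts positions from the units to the right: \<open>{0}\<close> is the units place and \<open>{1..}\<close> the places after
  the decimal point.\<close>

definition block :: "bool \<Rightarrow> nat \<Rightarrow> nat set \<Rightarrow> decimal" where
  "block s c I =
     \<lparr>negative = s, order = 0, digit = (\<lambda>p. if p \<le> 0 \<and> nat (- p) \<in> I then c else 0)\<rparr>"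

lemma block_decimal:
  assumes "c < 9 \<or> c = 9 \<and> finite I" "s \<Longrightarrow> c \<noteq> 0 \<and> I \<noteq> {}"
  shows "block s c I \<in> decimals"
proof -
  have "\<not> (\<forall>m\<le>n. digit (block s c I) m = 9)" for n
  proof
    assume nines: "\<forall>m\<le>n. digit (block s c I) m = 9"
    then have "c = 9"
      by (auto simp: block_def split: if_splits)
    then have "finite I"
      using assms(1) by simp
    moreover have "{nat (- n)..} \<subseteq> I"
    proof
      fix i assume "i \<in> {nat (- n)..}"
      then show "i \<in> I"
        using spec[OF nines, of "- int i"] by (auto simp: block_def split: if_splits)
    qed
    ultimately show False
      using finite_subset infinite_Ici by blast
  qed
  moreover have "\<exists>p\<le>0. digit (block s c I) p \<noteq> 0" if s
  proof -
    note nonzero = assms(2)[OF that]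
    then obtain i where "i \<in> I"
      by blast
    then show ?thesis
      using nonzero by (auto simp: block_def intro!: exI[of _ "- int i"])
  qed
  moreover have "digit (block s c I) n \<in> {0..9}" for n
    using assms(1) by (auto simp: block_def)
  moreover have "digit (block s c I) n = 0" if "n > 0" for n
    using that by (simp add: block_def)
  moreover have "order (block s c I) = 0" "negative (block s c I) = s"
    by (simp_all add: block_def)
  ultimately show ?thesis
    unfolding decimals_def by auto
qed

lemma real_value_block:
  assumes "(\<lambda>i. if i \<in> I then (1/10) ^ i else 0) sums v"
  shows "real_value (block s c I) = (if s then - 1 else 1) * real c * v"
proof -
  have "(\<lambda>i. real c * (if i \<in> I then (1/10) ^ i else 0)) sums (real c * v)"
    using assms by (rule sums_mult)
  then have "digit_series (\<lambda>i. if i \<in> I then c else 0) = real c * v"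
    by (simp add: digit_series_def sums_iff if_distrib if_distribR cong: if_cong)
  then show ?thesis
    by (simp add: real_value_def decimal_sign_def block_def)
qed

lemma real_value_block_finite:
  assumes "finite I"
  shows "real_value (block s c I) = (if s then - 1 else 1) * real c * (\<Sum>i\<in>I. (1/10) ^ i)"
  by (rule real_value_block) (use assms in \<open>rule sums_If_finite_set\<close>)

lemma sum_tenths: "(\<Sum>i\<in>{1..n}. (1/10) ^ i) = (1 - (1/10) ^ n) / (9 :: real)"
proof (induction n)
  case (Suc n)
  have "(\<Sum>i\<in>{1..Suc n}. (1/10) ^ i) = (1 - (1/10) ^ n) / 9 + (1/10 :: real) ^ Suc n"
    using Suc by simp
  also have "\<dots> = (1 - (1/10) ^ Suc n) / 9"
    by (simp add: field_simps)
  finally show ?case .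
qed simp

lemma one_ninth_sums: "(\<lambda>i. if i \<in> {1..} then (1/10) ^ i else 0) sums (1/9 :: real)"
proof -
  have "(\<lambda>i. (1/10) ^ i) sums (1 / (1 - 1/10) :: real)"
    by (rule geometric_sums) simp
  moreover have "(\<lambda>i. if i \<in> {0} then (1/10) ^ i else 0) sums (1 :: real)"
    using sums_If_finite_set[of "{0}" "\<lambda>i. (1/10 :: real) ^ i"] by simp
  ultimately have "(\<lambda>i. (1/10) ^ i - (if i \<in> {0} then (1/10) ^ i else 0)) sums (1 / (1 - 1/10) - 1 :: real)"
    by (rule sums_diff)
  moreover have "(1/10) ^ i - (if i \<in> {0} then (1/10) ^ i else 0) = (if i \<in> {1..} then (1/10) ^ i else 0 :: real)"
    for i :: nat
    by auto
  ultimately show ?thesis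
    by simp
qed

lemma encode_block:
  "encode (block s c I) =
     ((if s then [Minus] else []) @ [Digit 0, Sep]) \<frown> (\<lambda>i. Digit (if i \<in> I then c else 0))"
  by (simp add: encode_def block_def binary.simps[of 0])

lemma converges_block:
  assumes "\<And>i. \<forall>\<^sub>F n in sequentially. i \<in> I n \<longleftrightarrow> i \<in> J"
  shows "converges (\<lambda>n. encode (block s c (I n))) (encode (block s c J) :: 'a symbol word)"
  unfolding converges_def
proof
  fix i
  define p :: "'a symbol list" where "p = (if s then [Minus] else []) @ [Digit 0, Sep]"
  have enc: "encode (block s c I) = p \<frown> (\<lambda>i. Digit (if i \<in> I then c else 0))" for I
    by (simp add: encode_block p_def)
  show "\<forall>\<^sub>F n in sequentially. encode (block s c (I n)) i = (encode (block s c J) i :: 'a symbol)"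
    using assms[of "i - length p"] by eventually_elim (simp add: enc conc_def)
qed

text \<open>The words differ already in the units digit, which stands after the separation symbol, at
  index \<open>2\<close>, or \<open>3\<close> if there is a minus sign. The lower bound \<open>1\<close> on the number of nines
  excludes \<open>- 0\<close>, which is not a decimal.\<close>

lemma nines_not_converge_to_one:
  "\<not> converges (\<lambda>n. encode (block s 9 {1..Suc n})) (encode (block s 1 {0}))"
proof
  assume "converges (\<lambda>n. encode (block s 9 {1..Suc n}) :: 'a symbol word) (encode (block s 1 {0}))"
  then have "\<forall>\<^sub>F n in sequentially. encode (block s 9 {1..Suc n}) (if s then 3 else 2)
      = (encode (block s 1 {0}) (if s then 3 else 2) :: 'a symbol)"
    unfolding converges_def by blast
  then show False
    by (cases s) (simp_all add: encode_block conc_def)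
qed

text \<open>The argument common to addition and multiplication: the first operand stays fixed, the second
  converges, and the results are \<open>0.9\<dots>9\<close> with limit value \<open>1\<close>, up to a common sign.\<close>

lemma discontinuity_not_computable:
  fixes g :: "'a symbol word \<Rightarrow> 'a symbol word"
  assumes "equivalence canonical_alphabet X_R A X g"
    and d: "d \<in> decimals"
    and e: "\<And>n. e n \<in> decimals" "e' \<in> decimals"
    and converge: "converges (\<lambda>n. encode (e n)) (encode e' :: 'a symbol word)"
    and F: "\<And>n. F d (e n) = block s 9 {1..Suc n}" "F d e' = block s 1 {0}"
  shows "\<not> computable A X (conjugate X_R g (conjugate decimals encode F))"
proof
  let ?F = "conjugate decimals encode F :: 'a symbol word \<Rightarrow> _"
  assume computable: "computable A X (conjugate X_R g ?F)"
  have enc: "encode f \<in> X_R" if "f \<in> decimals" for f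
    using that by (simp add: X_R_def)
  have nines: "block s 9 {1..Suc n} \<in> decimals" for n
    by (rule block_decimal) auto
  have one: "block s 1 {0} \<in> decimals"
    by (rule block_decimal) auto
  have results: "?F (encode d) (encode (e n)) = encode (block s 9 {1..Suc n})"
    "?F (encode d) (encode e') = encode (block s 1 {0})" for n
    using d e F by (simp_all add: conjugate_encode)
  have "converges (\<lambda>n. ?F (encode d) (encode (e n))) (?F (encode d) (encode e'))"
    by (rule computable_conjugate_continuous[OF assms(1) computable])
      (simp_all only: results, (rule enc d e nines one converge converges_const)+)
  then show False
    by (simp only: results nines_not_converge_to_one)
qed

theorem corollary4p4:
  fixes A :: "'a symbol set" and X :: "'a symbol word set"
    and g :: "'a symbol word \<Rightarrow> 'a symbol word"
  assumes "encoding A X"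
    and "equivalence canonical_alphabet X_R A X g"
  shows "\<not> computable A X (conjugate X_R g plus_R) \<and>
         \<not> computable A X (conjugate X_R g times_R)"
proof
  show "\<not> computable A X (conjugate X_R g plus_R)"
    unfolding plus_R_def
  proof (rule discontinuity_not_computable[OF assms(2)])
    \<comment> \<open>Decimals symbolwise close to a finite one are not smaller in absolute value, so the sum of
      two finite decimals can jump only when their signs are opposite.\<close>
    show one: "block True 1 {0} \<in> decimals" and tenth: "block False 1 {Suc n} \<in> decimals"
      and zero: "block False 1 {} \<in> decimals" for n
      by (rule block_decimal; simp)+
    have nines: "block True 9 {1..Suc n} \<in> decimals" for n
      by (rule block_decimal) simp_all
    show "dec_add (block True 1 {0}) (block False 1 {Suc n}) = block True 9 {1..Suc n}" for n
    proof (rule dec_add_eq[OF one tenth nines])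
      show "real_value (block True 9 {1..Suc n})
          = real_value (block True 1 {0}) + real_value (block False 1 {Suc n})"
        by (simp only: real_value_block_finite finite.emptyI finite_insert finite_atLeastAtMost sum_tenths) simp
    qed
    show "dec_add (block True 1 {0}) (block False 1 {}) = block True 1 {0}"
      by (rule dec_add_eq[OF one zero one]) (simp add: real_value_block_finite)
    show "converges (\<lambda>n. encode (block False 1 {Suc n})) (encode (block False 1 {}) :: 'a symbol word)"
    proof (rule converges_block)
      fix i :: nat
      show "\<forall>\<^sub>F n in sequentially. i \<in> {Suc n} \<longleftrightarrow> i \<in> {}"
        using eventually_ge_at_top[of i] by eventually_elim auto
    qed
  qed
  show "\<not> computable A X (conjugate X_R g times_R)"
    unfolding times_R_def
  proof (rule discontinuity_not_computable[OF assms(2)])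
    \<comment> \<open>Truncations approach one third symbolwise from below; a finite decimal cannot be approached
      by decimals of smaller absolute value.\<close>
    show three: "block False 3 {0} \<in> decimals" and threes: "block False 3 {1..Suc n} \<in> decimals"
      and third: "block False 3 {1..} \<in> decimals" for n
      by (rule block_decimal; simp)+
    have nines: "block False 9 {1..Suc n} \<in> decimals" and one: "block False 1 {0} \<in> decimals" for n
      by (rule block_decimal; simp)+
    show "dec_mult (block False 3 {0}) (block False 3 {1..Suc n}) = block False 9 {1..Suc n}" for n
      by (rule dec_mult_eq[OF three threes nines])
        (simp add: real_value_block_finite del: sum.cl_ivl_Suc)
    show "dec_mult (block False 3 {0}) (block False 3 {1..}) = block False 1 {0}"
      by (rule dec_mult_eq[OF three third one])
        (simp add: real_value_block_finite real_value_block[OF one_ninth_sums] del: One_nat_def)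
    show "converges (\<lambda>n. encode (block False 3 {1..Suc n})) (encode (block False 3 {1..}) :: 'a symbol word)"
    proof (rule converges_block)
      fix i :: nat
      show "\<forall>\<^sub>F n in sequentially. i \<in> {1..Suc n} \<longleftrightarrow> i \<in> {1..}"
        using eventually_ge_at_top[of i] by eventually_elim auto
    qed
  qed
qed

end
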